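(* Let $X_n=\{x_1,\dots,x_n\}\subset\mathbb{R}^d$ be a set of data points and let $x\in\mathbb{R}^d$. Then the Power Function $P_{X_n}$ satisfies $$P_{X_n}(x)\ \ge\ \frac{1}{\|b\|_K}$$ for all bump functions $b$ with support radius $\mathrm{dist}(x,X_n)$ or smaller, i.e. for all $b\in\mathcal{B}_r$ with $0<r\le\mathrm{dist}(x,X_n)$.
   Context: $K$ is a continuous symmetric positive definite translation-invariant real-valued kernel on $\mathbb{R}^d\times\mathbb{R}^d$, and $\mathcal{K}$ is its native space, i.e. the Hilbert space of functions on $\mathbb{R}^d$ with inner product $(\cdot,\cdot)_K$ and norm $\|\cdot\|_K$ for which $K$ is the reproducing kernel. The Power Function is $P_{X_n}(x)=\sup\{f(x) : f\in\mathcal{K},\ \|f\|_K\le 1,\ f(x_j)=0,\ 1\le j\le n\}$; equivalently it is the distance of the point evaluation $\delta_x$ to the span of $\delta_{x_1},\dots,\delta_{x_n}$ in the dual norm of $\mathcal{K}^*$. The distance is $\mathrm{dist}(x,X_n)=\min_{1\le j\le n}\|x-x_j\|_2$. The set of bump functions of support radius $r$ is $\mathcal{B}_r:=\{b\in\mathcal{K} : b(0)=1,\ b(y)=0 \text{ for all } \|y\|_2\ge r\}$. *)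

theory Defs
  imports "HOL-Analysis.Analysis"
begin

definition symmetric_kernel :: "('a \<Rightarrow> 'a \<Rightarrow> real) \<Rightarrow> bool" where
  "symmetric_kernel K \<longleftrightarrow> (\<forall>x y. K x y = K y x)"

(* The weak inequality is the Moore-Aronszajn convention. It is implied by the strict one
   (positivity for pairwise distinct points and nonzero coefficients), so statements
   assuming it cover both usages of "positive definite". *)
definition positive_definite_kernel :: "('a \<Rightarrow> 'a \<Rightarrow> real) \<Rightarrow> bool" where
  "positive_definite_kernel K \<longleftrightarrow>
     (\<forall>X c. finite X \<longrightarrow> (\<Sum>x\<in>X. \<Sum>y\<in>X. c x * c y * K x y) \<ge> 0)"

definition translation_invariant_kernel :: "('a::ab_group_add \<Rightarrow> 'a \<Rightarrow> real) \<Rightarrow> bool" where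
  "translation_invariant_kernel K \<longleftrightarrow> (\<forall>x y z. K (x + z) (y + z) = K x y)"

definition kernel_norm :: "(('a \<Rightarrow> real) \<Rightarrow> ('a \<Rightarrow> real) \<Rightarrow> real) \<Rightarrow> ('a \<Rightarrow> real) \<Rightarrow> real" where
  "kernel_norm ip f = sqrt (ip f f)"

(* H is the carrier of the function space and ip its inner product; the values of ip
   outside H are irrelevant. By the Moore-Aronszajn theorem, K determines H and the
   restriction of ip to H uniquely. *)
locale native_space =
  fixes K :: "'a \<Rightarrow> 'a \<Rightarrow> real"
    and H :: "('a \<Rightarrow> real) set"
    and ip :: "('a \<Rightarrow> real) \<Rightarrow> ('a \<Rightarrow> real) \<Rightarrow> real"
  assumes zero_mem: "(\<lambda>_. 0) \<in> H"
    and add_mem: "f \<in> H \<Longrightarrow> g \<in> H \<Longrightarrow> (\<lambda>y. f y + g y) \<in> H"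
    and scale_mem: "f \<in> H \<Longrightarrow> (\<lambda>y. c * f y) \<in> H"
    and ip_commute: "f \<in> H \<Longrightarrow> g \<in> H \<Longrightarrow> ip f g = ip g f"
    and ip_add_left:
      "f \<in> H \<Longrightarrow> g \<in> H \<Longrightarrow> h \<in> H \<Longrightarrow> ip (\<lambda>y. f y + g y) h = ip f h + ip g h"
    and ip_scale_left: "f \<in> H \<Longrightarrow> g \<in> H \<Longrightarrow> ip (\<lambda>y. c * f y) g = c * ip f g"
    and ip_nonneg: "f \<in> H \<Longrightarrow> ip f f \<ge> 0"
    and ip_eq_zero: "f \<in> H \<Longrightarrow> ip f f = 0 \<Longrightarrow> f = (\<lambda>_. 0)"
    and complete: "Metric_space.mcomplete H (\<lambda>f g. kernel_norm ip (\<lambda>y. f y - g y))"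
    and kernel_mem: "(\<lambda>y. K y x) \<in> H"
    and reproducing: "f \<in> H \<Longrightarrow> ip f (\<lambda>y. K y x) = f x"

(* Over a native space the supremum is taken over a nonempty set that is bounded above
   by sqrt (K x x). *)
definition power_function ::
  "('a \<Rightarrow> real) set \<Rightarrow> (('a \<Rightarrow> real) \<Rightarrow> ('a \<Rightarrow> real) \<Rightarrow> real) \<Rightarrow> 'a set \<Rightarrow> 'a \<Rightarrow> real" where
  "power_function H ip X x = Sup {f x | f. f \<in> H \<and> kernel_norm ip f \<le> 1 \<and> (\<forall>y\<in>X. f y = 0)}"

definition dist_to_points :: "'a::metric_space \<Rightarrow> 'a set \<Rightarrow> real" where
  "dist_to_points x X = Min ((\<lambda>y. dist x y) ` X)"

definition bump_functions ::
  "('a::real_normed_vector \<Rightarrow> real) set \<Rightarrow> real \<Rightarrow> ('a \<Rightarrow> real) set" where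
  "bump_functions H r = {b \<in> H. b 0 = 1 \<and> (\<forall>y. norm y \<ge> r \<longrightarrow> b y = 0)}"

end

(* Gram-Schmidt yields a = K(., x) - sum_j c_j K(., x_j) vanishing on X; then a(x) = ||a||^2,
   so a / ||a|| shows P_X(x) >= ||a||. Shifting the centres by -x turns a into
   a' = K(., 0) - sum_j c_j K(., x_j - x), of the same norm since K is translation invariant.
   By the reproducing property (b, a') = b(0) - sum_j c_j b(x_j - x) = 1, and Cauchy-Schwarz
   gives 1 <= ||b|| ||a||. This avoids showing that the native space itself is translation
   invariant, which would need density of the kernel translates. *)

theory Submission
  imports Defs
begin

context native_space
begin

lemma ip_add_right:
  assumes "f \<in> H" "g \<in> H" "h \<in> H"
  shows "ip f (\<lambda>y. g y + h y) = ip f g + ip f h"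
  using ip_add_left[OF assms(2,3,1)] assms by (simp add: add_mem ip_commute[of f])

lemma ip_scale_right:
  assumes "f \<in> H" "g \<in> H"
  shows "ip f (\<lambda>y. c * g y) = c * ip f g"
  using ip_scale_left[OF assms(2,1)] assms by (simp add: scale_mem ip_commute[of f])

lemma ip_zero_right:
  assumes "f \<in> H"
  shows "ip f (\<lambda>_. 0) = 0"
  using ip_scale_right[OF assms zero_mem, of 0] by simp

lemma diff_scale_mem:
  assumes "f \<in> H" "g \<in> H"
  shows "(\<lambda>y. f y - c * g y) \<in> H"
  using add_mem[OF assms(1) scale_mem[OF assms(2), of "- c"]] by simp

lemma ip_diff_scale_right:
  assumes "f \<in> H" "g \<in> H" "h \<in> H"
  shows "ip f (\<lambda>y. g y - c * h y) = ip f g - c * ip f h"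
  using ip_add_right[OF assms(1,2) scale_mem[OF assms(3), of "- c"]]
    ip_scale_right[OF assms(1,3), of "- c"] by simp

lemma Cauchy_Schwarz:
  assumes f: "f \<in> H" and g: "g \<in> H"
  shows "(ip f g)\<^sup>2 \<le> ip f f * ip g g"
proof (cases "ip g g = 0")
  case True
  then show ?thesis
    using ip_eq_zero[OF g] ip_zero_right[OF f] by simp
next
  case False
  then have pos: "ip g g > 0"
    using ip_nonneg[OF g] by simp
  \<comment> \<open>With this coefficient \<open>h\<close> is the part of \<open>f\<close>
    orthogonal to \<open>g\<close>, so \<open>ip h h\<close> reduces to
    \<open>ip f f - c * ip f g\<close>.\<close>
  define c where "c = ip f g / ip g g"
  define h where "h = (\<lambda>y. f y - c * g y)"
  have h: "h \<in> H"
    unfolding h_def by (rule diff_scale_mem[OF f g])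
  have "ip h h = ip h f - c * ip h g"
    using ip_diff_scale_right[OF h f g, of c] by (simp add: h_def)
  also have "ip h f = ip f f - c * ip f g"
    using ip_diff_scale_right[OF f f g, of c] ip_commute[OF h f] by (simp add: h_def)
  also have "ip h g = ip f g - c * ip g g"
    using ip_diff_scale_right[OF g f g, of c] ip_commute[OF h g] ip_commute[OF f g]
    by (simp add: h_def)
  also have "\<dots> = 0"
    using False by (simp add: c_def)
  finally have "c * ip f g \<le> ip f f"
    using ip_nonneg[OF h] by simp
  then have "c * ip f g * ip g g \<le> ip f f * ip g g"
    using pos by (intro mult_right_mono) auto
  moreover have "c * ip f g * ip g g = (ip f g)\<^sup>2"
    using False by (simp add: c_def power2_eq_square)
  ultimately show ?thesis by simp
qed

text \<open>Both claims share one induction because linearity of \<open>ip\<close> needs membership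
  of the partial combination. Separating the index \<open>i\<close> from the centre
  \<open>t i\<close> lets the same coefficients serve for \<open>X\<close> and for its
  translate.\<close>

lemma kernel_combination:
  assumes "finite I" "f \<in> H"
  shows "(\<lambda>y. K y p - (\<Sum>i\<in>I. c i * K y (t i))) \<in> H \<and>
    ip f (\<lambda>y. K y p - (\<Sum>i\<in>I. c i * K y (t i))) = f p - (\<Sum>i\<in>I. c i * f (t i))"
  using assms(1)
proof (induction I)
  case empty
  then show ?case
    using kernel_mem reproducing[OF assms(2)] by simp
next
  case (insert j I)
  let ?g = "\<lambda>y. K y p - (\<Sum>i\<in>I. c i * K y (t i))"
  have eq: "(\<lambda>y. K y p - (\<Sum>i\<in>insert j I. c i * K y (t i))) = (\<lambda>y. ?g y - c j * K y (t j))"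
    using insert.hyps by (simp add: algebra_simps)
  show ?case
    unfolding eq
    using insert diff_scale_mem[OF _ kernel_mem] ip_diff_scale_right[OF assms(2) _ kernel_mem]
      reproducing[OF assms(2)]
    by simp
qed

lemmas kernel_combination_mem = kernel_combination[OF _ zero_mem, THEN conjunct1]
  and ip_kernel_combination = kernel_combination[THEN conjunct2]

text \<open>The Gram matrix of \<open>X\<close> may be singular, so it is not inverted. Adding a
  point \<open>q\<close> combines the residuals of \<open>p\<close> and of \<open>q\<close> with
  respect to the old points, which is why the induction runs over arbitrary
  \<open>p\<close>.\<close>

lemma kernel_residual_exists:
  assumes "finite X"
  shows "\<exists>c. \<forall>y\<in>X. K y p - (\<Sum>z\<in>X. c z * K y z) = 0"
  using assms
proof (induction X arbitrary: p)
  case empty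
  then show ?case by simp
next
  case (insert q X)
  obtain c where c: "\<And>y. y \<in> X \<Longrightarrow> K y p - (\<Sum>z\<in>X. c z * K y z) = 0"
    using insert.IH by blast
  obtain d where d: "\<And>y. y \<in> X \<Longrightarrow> K y q - (\<Sum>z\<in>X. d z * K y z) = 0"
    using insert.IH by blast
  define u where "u = (\<lambda>y. K y p - (\<Sum>z\<in>X. c z * K y z))"
  define w where "w = (\<lambda>y. K y q - (\<Sum>z\<in>X. d z * K y z))"
  have mem: "u \<in> H" "w \<in> H"
    unfolding u_def w_def by (rule kernel_combination_mem[OF insert.hyps(1)])+
  have van: "u y = 0" "w y = 0" if "y \<in> X" for y
    using c[OF that] d[OF that] by (simp_all add: u_def w_def)
  \<comment> \<open>\<open>w\<close> is \<open>K y q\<close> minus kernels centred in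
    \<open>X\<close>, and the latter only see the values of \<open>f\<close> on
    \<open>X\<close>.\<close>
  have w_right: "ip f w = f q" if "f \<in> H" "\<And>y. y \<in> X \<Longrightarrow> f y = 0" for f
    using ip_kernel_combination[OF insert.hyps(1) that(1), of q d "\<lambda>z. z"] that(2)
    by (simp add: w_def)
  \<comment> \<open>Here \<open>ip w w = w q = 0\<close> forces \<open>w\<close> to be zero, hence
    \<open>u q = ip u w = 0\<close>.\<close>
  have degenerate: "u q = 0" if "w q = 0"
  proof -
    have "w = (\<lambda>_. 0)"
      using ip_eq_zero w_right[of w] mem van that by simp
    then show ?thesis
      using w_right[of u] mem van ip_zero_right by simp
  qed
  \<comment> \<open>This makes \<open>u - s * w\<close> vanish at \<open>q\<close>. If
    \<open>w q = 0\<close>, division by zero gives \<open>s = 0\<close>, and \<open>u\<close> itself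
    already vanishes there.\<close>
  define s where "s = u q / w q"
  \<comment> \<open>These are the coefficients of \<open>u - s * w\<close>; since \<open>q\<close>
    is not in \<open>X\<close>, the two cases do not clash.\<close>
  define e where "e = (\<lambda>z. if z = q then s else c z - s * d z)"
  have "K y p - (\<Sum>z\<in>insert q X. e z * K y z) = u y - s * w y" for y
  proof -
    have "(\<Sum>z\<in>X. e z * K y z) = (\<Sum>z\<in>X. (c z - s * d z) * K y z)"
      using insert.hyps(2) by (intro sum.cong) (auto simp: e_def)
    also have "\<dots> = (\<Sum>z\<in>X. c z * K y z) - s * (\<Sum>z\<in>X. d z * K y z)"
      by (simp add: algebra_simps sum_subtractf sum_distrib_left)
    finally show ?thesis
      using insert.hyps by (simp add: u_def w_def e_def algebra_simps)
  qed
  moreover have "u q - s * w q = 0"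
    using degenerate by (simp add: s_def)
  ultimately show ?case
    using van by (intro exI[of _ e]) auto
qed

text \<open>A real \<open>Sup\<close> dominates its members only if the set is bounded above;
  Cauchy-Schwarz against the kernel at \<open>x\<close> supplies the bound.\<close>

lemma power_function_upper:
  assumes f: "f \<in> H" and "kernel_norm ip f \<le> 1" and "\<And>y. y \<in> X \<Longrightarrow> f y = 0"
  shows "f x \<le> power_function H ip X x"
proof -
  have "g x \<le> sqrt (K x x)" if g: "g \<in> H" and n: "kernel_norm ip g \<le> 1" for g
  proof -
    have "(g x)\<^sup>2 \<le> ip g g * K x x"
      using Cauchy_Schwarz[OF g kernel_mem, of x] reproducing[OF g] reproducing[OF kernel_mem]
      by simp
    also have "\<dots> \<le> 1 * K x x"
      using n ip_nonneg[OF kernel_mem, of x] reproducing[OF kernel_mem]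
      by (intro mult_right_mono) (auto simp: kernel_norm_def)
    finally show ?thesis
      by (simp add: real_le_rsqrt)
  qed
  then have "bdd_above {g x | g. g \<in> H \<and> kernel_norm ip g \<le> 1 \<and> (\<forall>y\<in>X. g y = 0)}"
    by (intro bdd_aboveI) auto
  then show ?thesis
    unfolding power_function_def using assms by (intro cSup_upper) auto
qed

end

theorem theorem1:
  fixes K :: "real ^ 'd \<Rightarrow> real ^ 'd \<Rightarrow> real"
    and H :: "(real ^ 'd \<Rightarrow> real) set"
    and ip :: "(real ^ 'd \<Rightarrow> real) \<Rightarrow> (real ^ 'd \<Rightarrow> real) \<Rightarrow> real"
    and X :: "(real ^ 'd) set"
    and x :: "real ^ 'd"
    and b :: "real ^ 'd \<Rightarrow> real"
    and r :: real
  assumes "continuous_on UNIV (\<lambda>(y, z). K y z)"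
    and "symmetric_kernel K"
    and "positive_definite_kernel K"
    and "translation_invariant_kernel K"
    and "native_space K H ip"
    and "finite X" and "X \<noteq> {}"
    and "0 < r" and "r \<le> dist_to_points x X"
    and "b \<in> bump_functions H r"
  shows "power_function H ip X x \<ge> 1 / kernel_norm ip b"
proof -
  interpret native_space K H ip by fact
  have K_shift: "K (y + x) (z + x) = K y z" for y z
    using assms(4) by (simp add: translation_invariant_kernel_def)
  have b: "b \<in> H" "b 0 = 1" "\<And>y. norm y \<ge> r \<Longrightarrow> b y = 0"
    using assms(10) by (auto simp: bump_functions_def)
  have b_shift: "b (z - x) = 0" if "z \<in> X" for z
  proof -
    have "dist_to_points x X \<le> dist x z"
      using \<open>finite X\<close> that by (auto simp: dist_to_points_def)
    then show ?thesis
      using b(3) assms(9) by (simp add: dist_norm norm_minus_commute)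
  qed
  obtain c where c: "\<And>y. y \<in> X \<Longrightarrow> K y x - (\<Sum>z\<in>X. c z * K y z) = 0"
    using kernel_residual_exists[OF \<open>finite X\<close>] by blast
  define a where "a = (\<lambda>y. K y x - (\<Sum>z\<in>X. c z * K y z))"
  define a' where "a' = (\<lambda>y. K y 0 - (\<Sum>z\<in>X. c z * K y (z - x)))"
  have mem: "a \<in> H" "a' \<in> H"
    unfolding a_def a'_def by (rule kernel_combination_mem[OF \<open>finite X\<close>])+
  have a_van: "a y = 0" if "y \<in> X" for y
    using c[OF that] by (simp add: a_def)
  have a'_eq: "a' y = a (y + x)" for y
    using K_shift[of y 0] K_shift[of y "_ - x"] by (simp add: a_def a'_def)
  have ip_a: "ip a a = a x"
    using ip_kernel_combination[OF \<open>finite X\<close> mem(1), of x c "\<lambda>z. z"] a_van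
    by (simp add: a_def)
  have ip_a': "ip f a' = f 0 - (\<Sum>z\<in>X. c z * f (z - x))" if "f \<in> H" for f
    unfolding a'_def by (rule ip_kernel_combination[OF \<open>finite X\<close> that])
  \<comment> \<open>Evaluating gives \<open>a' 0 = a x\<close> and
    \<open>a' (z - x) = a z = 0\<close> for \<open>z\<close> in \<open>X\<close>.\<close>
  have "ip a' a' = a x"
    using ip_a'[OF mem(2)] a_van by (simp add: a'_eq)
  moreover have "ip b a' = 1"
    using ip_a'[OF b(1)] b(2) b_shift by simp
  ultimately have CS: "1 \<le> ip b b * a x"
    using Cauchy_Schwarz[OF b(1) mem(2)] by simp
  \<comment> \<open>The bump function is what keeps \<open>a\<close> from being zero: otherwise
    Cauchy-Schwarz would read \<open>1 \<le> 0\<close>.\<close>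
  have ax: "a x > 0"
    using CS ip_nonneg[OF mem(1)] ip_a by (cases "a x = 0") auto
  have bb: "ip b b > 0"
    using CS ip_nonneg[OF b(1)] by (cases "ip b b = 0") auto
  \<comment> \<open>As \<open>ip a a = a x\<close>, this is the factor that normalises
    \<open>a\<close>.\<close>
  define s where "s = 1 / sqrt (a x)"
  have "ip (\<lambda>y. s * a y) (\<lambda>y. s * a y) = 1"
    using ip_scale_left[OF mem(1) scale_mem[OF mem(1)], of s s] ip_scale_right[OF mem(1) mem(1), of s]
      ip_a ax by (simp add: s_def)
  then have "s * a x \<le> power_function H ip X x"
    using power_function_upper[OF scale_mem[OF mem(1), of s], of X x] a_van
    by (simp add: kernel_norm_def)
  moreover have "s * a x = sqrt (a x)"
    using ax by (simp add: s_def real_div_sqrt)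
  moreover have "1 / kernel_norm ip b \<le> sqrt (a x)"
    using real_sqrt_le_mono[OF CS] bb
    by (simp add: kernel_norm_def real_sqrt_mult field_simps)
  ultimately show ?thesis by simp
qed

end
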